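(* Let $n=2^\eta$ with $\eta\ge1$ an integer, let $\mu,\nu:G_n\to[0,1]$ be two probability measures on the $n\times n$ unit grid $G_n$ with cyclic boundary conditions, and let $\varepsilon_\mu,\varepsilon_\nu:G_n\to\mathbb{R}$ be independent signed noise measures, each distributed according to the zero-sum Gaussian noise model with parameter $\sigma>0$ described in the context. Then $$\mathbb{E}\Big[W_1^{\pm}(\mu+\varepsilon_\mu,\nu+\varepsilon_\nu)-W_1^{\pm}(\mu,\nu)\Big]\ \le\ \frac{4n\log_2 n+n}{\sqrt\pi}\,\sigma+\frac{\sqrt2}{n}.$$
   Context: $G_n=\{0,\tfrac1n,\dots,\tfrac{n-1}{n}\}^2$ is the $n\times n$ unit pixel grid with cyclic boundary conditions, with ground distance $\mathsf d$ the Euclidean (flat torus) distance $\mathsf d(x,y)=\big(\sum_{i=1}^2\min(|x_i-y_i|,1-|x_i-y_i|)^2\big)^{1/2}$. Functions on $G_n$ are identified with signed measures on $G_n$ (the value at a pixel is its point mass); $a_+=\max(a,0)$, $a_-=\max(-a,0)$ pixelwise. Zero-sum Gaussian noise model: with $m=n^2$, the vector of noise values $(\varepsilon(x))_{x\in G_n}$ is distributed as $\mathcal N(0,\Sigma)$, where $\Sigma$ is the $m\times m$ matrix with diagonal entries $\sigma^2$ and off-diagonal entries $-\sigma^2/(m-1)$. In particular $\sum_x\varepsilon(x)=0$ almost surely. For $p\in\mathbb N$, $p\ge1$, and nonnegative measures $\alpha,\beta$ on $G_n$ of equal total mass, $W_p(\alpha,\beta)=\big(\inf_{\pi}\sum_{x,y}\mathsf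 d(x,y)^p\pi(x,y)\big)^{1/p}$, where the infimum is over all nonnegative measures $\pi$ on $G_n\times G_n$ with marginals $\alpha,\beta$. For signed measures $\rho,\tau$ on $G_n$ of equal total mass, the signed Wasserstein discrepancy is $W_p^{\pm}(\rho,\tau)=W_p(\rho_++\tau_-,\ \tau_++\rho_-)$. *)

theory Defs
  imports "HOL-Probability.Probability"
begin

definition grid :: "nat \<Rightarrow> (real \<times> real) set" where
  "grid n = (\<lambda>k. real k / real n) ` {..<n} \<times> (\<lambda>k. real k / real n) ` {..<n}"

definition torus_dist :: "real \<times> real \<Rightarrow> real \<times> real \<Rightarrow> real" where
  "torus_dist x y =
     sqrt ((min \<bar>fst x - fst y\<bar> (1 - \<bar>fst x - fst y\<bar>))\<^sup>2
         + (min \<bar>snd x - snd y\<bar> (1 - \<bar>snd x - snd y\<bar>))\<^sup>2)"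

(* A (signed) measure on the grid is represented by its point masses, that is, by a function on
   real \<times> real; only its values on the grid are ever used. *)

definition couplings ::
  "nat \<Rightarrow> (real \<times> real \<Rightarrow> real) \<Rightarrow> (real \<times> real \<Rightarrow> real)
     \<Rightarrow> (real \<times> real \<Rightarrow> real \<times> real \<Rightarrow> real) set" where
  "couplings n \<alpha> \<beta> =
     {\<pi>. (\<forall>x\<in>grid n. \<forall>y\<in>grid n. 0 \<le> \<pi> x y) \<and>
         (\<forall>x\<in>grid n. (\<Sum>y\<in>grid n. \<pi> x y) = \<alpha> x) \<and>
         (\<forall>y\<in>grid n. (\<Sum>x\<in>grid n. \<pi> x y) = \<beta> y)}"

(* Meaningful for p \<ge> 1 and nonnegative \<alpha>, \<beta> of equal total mass.  If the masses differ, the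
   infimum is Inf {}, an unspecified constant. *)
definition wasserstein ::
  "nat \<Rightarrow> nat \<Rightarrow> (real \<times> real \<Rightarrow> real) \<Rightarrow> (real \<times> real \<Rightarrow> real) \<Rightarrow> real" where
  "wasserstein p n \<alpha> \<beta> =
     root p (INF \<pi>\<in>couplings n \<alpha> \<beta>. \<Sum>x\<in>grid n. \<Sum>y\<in>grid n. torus_dist x y ^ p * \<pi> x y)"

definition signed_wasserstein ::
  "nat \<Rightarrow> nat \<Rightarrow> (real \<times> real \<Rightarrow> real) \<Rightarrow> (real \<times> real \<Rightarrow> real) \<Rightarrow> real" where
  "signed_wasserstein p n \<rho> \<tau> =
     wasserstein p n (\<lambda>x. max (\<rho> x) 0 + max (- \<tau> x) 0) (\<lambda>x. max (\<tau> x) 0 + max (- \<rho> x) 0)"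

definition prob_on_grid :: "nat \<Rightarrow> (real \<times> real \<Rightarrow> real) \<Rightarrow> bool" where
  "prob_on_grid n \<mu> \<longleftrightarrow> (\<forall>x\<in>grid n. 0 \<le> \<mu> x \<and> \<mu> x \<le> 1) \<and> (\<Sum>x\<in>grid n. \<mu> x) = 1"

(* The one-dimensional normal law with mean m and variance v, where v = 0 gives a point mass. *)
definition normal_law :: "real \<Rightarrow> real \<Rightarrow> real measure" where
  "normal_law m v =
     (if v = 0 then return borel m else density lborel (\<lambda>t. ennreal (normal_density m (sqrt v) t)))"

(* X has the multivariate normal law N(m, C) on the finite index set I.  The definition through
   linear combinations also covers singular C; the covariance of the zero-sum noise is singular. *)
definition gaussian_vector ::
  "'a measure \<Rightarrow> 'i set \<Rightarrow> ('i \<Rightarrow> real) \<Rightarrow> ('i \<Rightarrow> 'i \<Rightarrow> real) \<Rightarrow> ('a \<Rightarrow> 'i \<Rightarrow> real) \<Rightarrow> bool" where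
  "gaussian_vector M I m C X \<longleftrightarrow>
     (\<forall>i\<in>I. (\<lambda>\<omega>. X \<omega> i) \<in> borel_measurable M) \<and>
     (\<forall>t. distr M borel (\<lambda>\<omega>. \<Sum>i\<in>I. t i * X \<omega> i)
          = normal_law (\<Sum>i\<in>I. t i * m i) (\<Sum>i\<in>I. \<Sum>j\<in>I. t i * C i j * t j))"

definition zero_sum_cov :: "nat \<Rightarrow> real \<Rightarrow> real \<times> real \<Rightarrow> real \<times> real \<Rightarrow> real" where
  "zero_sum_cov n \<sigma> x y = (if x = y then \<sigma>\<^sup>2 else - \<sigma>\<^sup>2 / (real (n\<^sup>2) - 1))"

definition zero_sum_noise ::
  "'a measure \<Rightarrow> nat \<Rightarrow> real \<Rightarrow> ('a \<Rightarrow> real \<times> real \<Rightarrow> real) \<Rightarrow> bool" where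
  "zero_sum_noise M n \<sigma> \<epsilon> \<longleftrightarrow> gaussian_vector M (grid n) (\<lambda>_. 0) (zero_sum_cov n \<sigma>) \<epsilon>"

end

theory Submission
  imports Defs
begin

text \<open>
  For exponent 1 the optimal transport cost of two nonnegative measures depends only on their
  difference. Hence the signed discrepancy of \<open>\<rho>\<close> and \<open>\<tau>\<close> is a seminorm (the Kantorovich norm) of the
  zero-sum measure \<open>\<rho> - \<tau>\<close>, and the triangle inequality bounds the change caused by the noise by the
  Kantorovich norm of \<open>\<epsilon>\<mu> - \<epsilon>\<nu>\<close>: the images \<open>\<mu>\<close>, \<open>\<nu>\<close> drop out.

  That transport depends only on the difference is the cancellation property
  \<open>wasserstein_1_cancel\<close>: mass common to both sides can be left where it is. It rests on the
  triangle inequality of the ground distance, since mass that is brought to a pixel \<open>v\<close> while other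
  mass is taken away from \<open>v\<close> may as well bypass \<open>v\<close> (\<open>coupling_shortcut\<close>).

  The norm of a zero-sum measure \<open>\<delta>\<close> is bounded by transporting it up the dyadic tree: the square
  cells of side \<open>2\<^sup>i\<close> pixels send their total (signed) mass from their lower left corner to
  the lower left corner of the parent cell, at distance at most \<open>sqrt 2 * 2\<^sup>i / n\<close>, and at
  the root everything cancels (\<open>kantorovich_norm_le_tree_cost\<close>). For the noise, the
  sum over a cell of \<open>4\<^sup>i\<close> pixels is a centred normal variable of variance at most
  \<open>4\<^sup>i * \<sigma>\<^sup>2\<close>, because the correlations are negative, so its mean absolute value
  is at most \<open>2\<^sup>i * \<sigma> * sqrt (2 / pi)\<close>. With \<open>n\<^sup>2 / 4\<^sup>i\<close> cells at level \<open>i\<close>, each of the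
  \<open>\<eta> = log 2 n\<close> levels contributes at most \<open>2 * n * \<sigma> / sqrt pi\<close> for each of the two noise vectors
  (\<open>expected_tree_cost\<close>), which adds up to \<open>4 * n * log 2 n * \<sigma> / sqrt pi\<close>.

  Integrability also needs measurability of the discrepancy, an infimum over an uncountable set that
  itself depends on the noise. It holds because the Kantorovich norm is Lipschitz in the point masses
  (\<open>kantorovich_norm_measurable\<close>).
\<close>

section \<open>The ground distance\<close>

lemma finite_grid [simp]: "finite (grid n)"
  by (simp add: grid_def)

lemma grid_coords: "x \<in> grid n \<Longrightarrow> fst x \<in> {0..1} \<and> snd x \<in> {0..1}"
  by (auto simp: grid_def divide_le_eq)

text \<open>With \<open>p\<close>, \<open>q\<close>, \<open>r\<close> the pairwise distances of three points of the unit interval, this is the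
  triangle inequality on the circle of length 1. The last assumption is for the case that both
  routes on the right go around the circle.\<close>

lemma min_triangle:
  fixes p q r :: real
  assumes "p \<le> q + r" "q \<le> p + r" "r \<le> p + q" "p + q + r \<le> 2"
  shows "min p (1 - p) \<le> min q (1 - q) + min r (1 - r)"
  using assms by (auto simp: min_def)

lemma circle_triangle:
  fixes a b c :: real
  assumes "a \<in> {0..1}" "b \<in> {0..1}" "c \<in> {0..1}"
  shows "min (\<bar>a - c\<bar>) (1 - \<bar>a - c\<bar>) \<le> min (\<bar>a - b\<bar>) (1 - \<bar>a - b\<bar>) + min (\<bar>b - c\<bar>) (1 - \<bar>b - c\<bar>)"
proof -
  have "\<bar>a - c\<bar> \<le> \<bar>a - b\<bar> + \<bar>b - c\<bar>" "\<bar>a - b\<bar> \<le> \<bar>a - c\<bar> + \<bar>b - c\<bar>"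
    "\<bar>b - c\<bar> \<le> \<bar>a - c\<bar> + \<bar>a - b\<bar>"
    by linarith+
  moreover have "\<bar>a - c\<bar> + \<bar>a - b\<bar> + \<bar>b - c\<bar> \<le> 2"
    using assms by (simp add: abs_if)
  ultimately show ?thesis
    by (rule min_triangle)
qed

lemma torus_dist_nonneg: "0 \<le> torus_dist x y"
  by (simp add: torus_dist_def)

lemma torus_dist_self [simp]: "torus_dist x x = 0"
  by (simp add: torus_dist_def)

lemma torus_dist_commute: "torus_dist x y = torus_dist y x"
  by (simp add: torus_dist_def abs_minus_commute)

lemma torus_dist_triangle:
  assumes "x \<in> grid n" "y \<in> grid n" "z \<in> grid n"
  shows "torus_dist x z \<le> torus_dist x y + torus_dist y z"
proof -
  define c where "c a b = min (\<bar>a - b\<bar>) (1 - \<bar>a - b\<bar>)" for a b :: real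
  have nonneg: "0 \<le> c a b" if "a \<in> {0..1}" "b \<in> {0..1}" for a b
    using that by (auto simp: c_def)
  note xyz = assms[THEN grid_coords]
  have "torus_dist x z \<le> sqrt ((c (fst x) (fst y) + c (fst y) (fst z))\<^sup>2
                             + (c (snd x) (snd y) + c (snd y) (snd z))\<^sup>2)"
    unfolding torus_dist_def c_def[symmetric]
    by (intro real_sqrt_le_mono add_mono power_mono nonneg)
       (use xyz circle_triangle in \<open>auto simp: c_def\<close>)
  also have "\<dots> \<le> torus_dist x y + torus_dist y z"
    unfolding torus_dist_def c_def[symmetric] by (rule real_sqrt_sum_squares_triangle_ineq)
  finally show ?thesis .
qed

section \<open>Couplings and the optimal cost\<close>

definition transport_cost :: "nat \<Rightarrow> (real \<times> real \<Rightarrow> real \<times> real \<Rightarrow> real) \<Rightarrow> real" where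
  "transport_cost n \<pi> = (\<Sum>x\<in>grid n. \<Sum>y\<in>grid n. torus_dist x y * \<pi> x y)"

lemma wasserstein_1: "wasserstein 1 n \<alpha> \<beta> = Inf (transport_cost n ` couplings n \<alpha> \<beta>)"
  by (simp add: wasserstein_def transport_cost_def)

lemma couplings_cong:
  assumes "\<And>x. x \<in> grid n \<Longrightarrow> \<alpha> x = \<alpha>' x" "\<And>x. x \<in> grid n \<Longrightarrow> \<beta> x = \<beta>' x"
  shows "couplings n \<alpha> \<beta> = couplings n \<alpha>' \<beta>'"
  using assms by (simp add: couplings_def)

lemma wasserstein_1_cong:
  assumes "\<And>x. x \<in> grid n \<Longrightarrow> \<alpha> x = \<alpha>' x" "\<And>x. x \<in> grid n \<Longrightarrow> \<beta> x = \<beta>' x"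
  shows "wasserstein 1 n \<alpha> \<beta> = wasserstein 1 n \<alpha>' \<beta>'"
  unfolding wasserstein_1 using couplings_cong[of n, OF assms] by simp

lemma couplingsI:
  assumes "\<And>x y. x \<in> grid n \<Longrightarrow> y \<in> grid n \<Longrightarrow> 0 \<le> \<pi> x y"
    and "\<And>x. x \<in> grid n \<Longrightarrow> (\<Sum>y\<in>grid n. \<pi> x y) = \<alpha> x"
    and "\<And>y. y \<in> grid n \<Longrightarrow> (\<Sum>x\<in>grid n. \<pi> x y) = \<beta> y"
  shows "\<pi> \<in> couplings n \<alpha> \<beta>"
  using assms by (simp add: couplings_def)

lemma couplingsD:
  assumes "\<pi> \<in> couplings n \<alpha> \<beta>"
  shows "x \<in> grid n \<Longrightarrow> y \<in> grid n \<Longrightarrow> 0 \<le> \<pi> x y"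
    and "x \<in> grid n \<Longrightarrow> (\<Sum>y\<in>grid n. \<pi> x y) = \<alpha> x"
    and "y \<in> grid n \<Longrightarrow> (\<Sum>x\<in>grid n. \<pi> x y) = \<beta> y"
  using assms by (auto simp: couplings_def)

lemma couplings_equal_mass:
  assumes "\<pi> \<in> couplings n \<alpha> \<beta>"
  shows "sum \<alpha> (grid n) = sum \<beta> (grid n)"
proof -
  have "sum \<alpha> (grid n) = (\<Sum>x\<in>grid n. \<Sum>y\<in>grid n. \<pi> x y)"
    using couplingsD(2)[OF assms] by simp
  also have "\<dots> = (\<Sum>y\<in>grid n. \<Sum>x\<in>grid n. \<pi> x y)"
    by (rule sum.swap)
  also have "\<dots> = sum \<beta> (grid n)"
    using couplingsD(3)[OF assms] by simp
  finally show ?thesis .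
qed

text \<open>The witness is the normalised product measure. In the case of mass zero the division by zero
  makes it the zero measure, which is then a coupling.\<close>

lemma couplings_nonempty:
  assumes "\<And>x. x \<in> grid n \<Longrightarrow> 0 \<le> \<alpha> x" "\<And>x. x \<in> grid n \<Longrightarrow> 0 \<le> \<beta> x"
    and mass: "sum \<alpha> (grid n) = sum \<beta> (grid n)"
  shows "couplings n \<alpha> \<beta> \<noteq> {}"
proof -
  define S where "S = sum \<alpha> (grid n)"
  have zero: "\<alpha> x = 0 \<and> \<beta> x = 0" if "S = 0" "x \<in> grid n" for x
    using that assms sum_nonneg_eq_0_iff[of "grid n" \<alpha>] sum_nonneg_eq_0_iff[of "grid n" \<beta>]
    by (auto simp: S_def)
  have "S \<ge> 0" using assms by (auto simp: S_def intro: sum_nonneg)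
  have "(\<lambda>x y. \<alpha> x * \<beta> y / S) \<in> couplings n \<alpha> \<beta>"
  proof (rule couplingsI)
    show "(\<Sum>y\<in>grid n. \<alpha> x * \<beta> y / S) = \<alpha> x" if "x \<in> grid n" for x
      using zero that mass
      by (cases "S = 0") (auto simp: S_def sum_divide_distrib[symmetric] sum_distrib_left[symmetric])
    show "(\<Sum>x\<in>grid n. \<alpha> x * \<beta> y / S) = \<beta> y" if "y \<in> grid n" for y
      using zero that mass
      by (cases "S = 0") (auto simp: S_def sum_divide_distrib[symmetric] sum_distrib_right[symmetric])
  qed (use assms \<open>S \<ge> 0\<close> in auto)
  then show ?thesis by blast
qed

lemma transport_cost_nonneg: "\<pi> \<in> couplings n \<alpha> \<beta> \<Longrightarrow> 0 \<le> transport_cost n \<pi>"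
  unfolding transport_cost_def
  by (intro sum_nonneg mult_nonneg_nonneg torus_dist_nonneg) (auto simp: couplings_def)

lemma wasserstein_1_le: "\<pi> \<in> couplings n \<alpha> \<beta> \<Longrightarrow> wasserstein 1 n \<alpha> \<beta> \<le> transport_cost n \<pi>"
  unfolding wasserstein_1
  by (rule cInf_lower) (auto intro!: bdd_belowI[of _ 0] transport_cost_nonneg)

lemma wasserstein_1_greatest:
  assumes "couplings n \<alpha> \<beta> \<noteq> {}" "\<And>\<pi>. \<pi> \<in> couplings n \<alpha> \<beta> \<Longrightarrow> c \<le> transport_cost n \<pi>"
  shows "c \<le> wasserstein 1 n \<alpha> \<beta>"
  unfolding wasserstein_1 by (rule cInf_greatest) (use assms in auto)

lemma wasserstein_1_add:
  assumes ne: "couplings n \<alpha> \<beta> \<noteq> {}" and ne': "couplings n \<alpha>' \<beta>' \<noteq> {}"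
  shows "wasserstein 1 n (\<lambda>x. \<alpha> x + \<alpha>' x) (\<lambda>x. \<beta> x + \<beta>' x)
           \<le> wasserstein 1 n \<alpha> \<beta> + wasserstein 1 n \<alpha>' \<beta>'" (is "?W \<le> _")
proof -
  have "?W \<le> transport_cost n \<pi> + transport_cost n \<pi>'"
    if "\<pi> \<in> couplings n \<alpha> \<beta>" "\<pi>' \<in> couplings n \<alpha>' \<beta>'" for \<pi> \<pi>'
  proof -
    have "(\<lambda>x y. \<pi> x y + \<pi>' x y) \<in> couplings n (\<lambda>x. \<alpha> x + \<alpha>' x) (\<lambda>x. \<beta> x + \<beta>' x)"
      using that by (auto simp: couplings_def sum.distrib)
    then have "?W \<le> transport_cost n (\<lambda>x y. \<pi> x y + \<pi>' x y)"
      by (rule wasserstein_1_le)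
    then show ?thesis by (simp add: transport_cost_def sum.distrib algebra_simps)
  qed
  then have "?W - transport_cost n \<pi>' \<le> wasserstein 1 n \<alpha> \<beta>" if "\<pi>' \<in> couplings n \<alpha>' \<beta>'" for \<pi>'
    by (intro wasserstein_1_greatest[OF ne]) (use that in \<open>force simp: algebra_simps\<close>)
  then have "?W - wasserstein 1 n \<alpha> \<beta> \<le> wasserstein 1 n \<alpha>' \<beta>'"
    by (intro wasserstein_1_greatest[OF ne']) (force simp: algebra_simps)
  then show ?thesis by simp
qed

lemma wasserstein_1_commute: "wasserstein 1 n \<alpha> \<beta> = wasserstein 1 n \<beta> \<alpha>"
proof -
  have le: "transport_cost n ` couplings n \<alpha> \<beta> \<subseteq> transport_cost n ` couplings n \<beta> \<alpha>" for \<alpha> \<beta>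
  proof safe
    fix \<pi> assume \<pi>: "\<pi> \<in> couplings n \<alpha> \<beta>"
    have "transport_cost n \<pi> = transport_cost n (\<lambda>x y. \<pi> y x)"
      unfolding transport_cost_def by (subst sum.swap) (simp add: torus_dist_commute)
    moreover have "(\<lambda>x y. \<pi> y x) \<in> couplings n \<beta> \<alpha>"
      using \<pi> by (auto simp: couplings_def)
    ultimately show "transport_cost n \<pi> \<in> transport_cost n ` couplings n \<beta> \<alpha>" by blast
  qed
  from le[of \<alpha> \<beta>] le[of \<beta> \<alpha>] show ?thesis unfolding wasserstein_1 by (simp add: subset_antisym)
qed

section \<open>Cancellation of common mass\<close>

text \<open>Since \<open>\<pi> v v = 0\<close>, all mass leaving \<open>v\<close> goes to other pixels and all mass arriving at \<open>v\<close> comes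
  from other pixels. An amount \<open>t\<close> of each is removed, proportionally over the targets and the sources,
  and the sources are joined to the targets directly by a product measure of mass \<open>t\<close>. By the triangle
  inequality the direct routes are not more expensive than those through \<open>v\<close>.\<close>

lemma coupling_shortcut:
  assumes v: "v \<in> grid n" and t: "t > 0"
    and \<alpha>: "0 \<le> \<alpha> v" and \<beta>: "0 \<le> \<beta> v"
    and \<pi>: "\<pi> \<in> couplings n (\<lambda>x. \<alpha> x + (if x = v then t else 0)) (\<lambda>x. \<beta> x + (if x = v then t else 0))"
    and diag: "\<pi> v v = 0"
  obtains \<pi>' where "\<pi>' \<in> couplings n \<alpha> \<beta>" "transport_cost n \<pi>' \<le> transport_cost n \<pi>"
proof
  define R where "R = \<alpha> v + t"
  define C where "C = \<beta> v + t"
  \<comment> \<open>\<open>b\<close> and \<open>c\<close> are the fractions of the outgoing mass \<open>R\<close> and of the incoming mass \<open>C\<close> that are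
    rerouted; \<open>a\<close> gives the product of the two marginals at \<open>v\<close> the mass \<open>t\<close>.\<close>
  define a where "a = t / (R * C)"
  define b where "b = t / R"
  define c where "c = t / C"
  have "R > 0" "C > 0"
    using t \<alpha> \<beta> by (auto simp: R_def C_def)
  then have bR: "b * R = t" and cC: "c * C = t" and aR: "a * R = c" and aC: "a * C = b"
    and a: "0 \<le> a" and b: "b \<le> 1" and c: "c \<le> 1"
    using t \<alpha> \<beta> by (auto simp: a_def b_def c_def R_def C_def)
  note nonneg = couplingsD(1)[OF \<pi>]
  have row: "(\<Sum>y\<in>grid n. \<pi> v y) = R" and col: "(\<Sum>x\<in>grid n. \<pi> x v) = C"
    using couplingsD(2,3)[OF \<pi> v] by (auto simp: R_def C_def)
  define \<pi>' where "\<pi>' x y = \<pi> x y + a * (\<pi> x v * \<pi> v y)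
      - (if x = v then b * \<pi> v y else 0) - (if y = v then c * \<pi> x v else 0)" for x y
  show "\<pi>' \<in> couplings n \<alpha> \<beta>"
  proof (rule couplingsI)
    fix x y assume xy: "x \<in> grid n" "y \<in> grid n"
    have "0 \<le> a * (\<pi> x v * \<pi> v y)" using nonneg xy v a by simp
    moreover have "b * \<pi> v y \<le> \<pi> v y" "c * \<pi> x v \<le> \<pi> x v"
      using mult_right_mono[OF b nonneg[OF v xy(2)]] mult_right_mono[OF c nonneg[OF xy(1) v]]
      by simp_all
    ultimately show "0 \<le> \<pi>' x y" using nonneg[OF xy] diag by (auto simp: \<pi>'_def)
  next
    fix x assume x: "x \<in> grid n"
    have "(\<Sum>y\<in>grid n. \<pi>' x y) = (\<Sum>y\<in>grid n. \<pi> x y) + (a * R) * \<pi> x v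
        - (if x = v then b * R else 0) - c * \<pi> x v"
      using v by (simp add: \<pi>'_def sum.distrib sum_subtractf row[symmetric] sum_distrib_left
          sum_distrib_right mult_ac)
    then show "(\<Sum>y\<in>grid n. \<pi>' x y) = \<alpha> x"
      using couplingsD(2)[OF \<pi> x] by (cases "x = v") (simp_all add: aR bR)
  next
    fix y assume y: "y \<in> grid n"
    have "(\<Sum>x\<in>grid n. \<pi>' x y) = (\<Sum>x\<in>grid n. \<pi> x y) + (a * C) * \<pi> v y
        - b * \<pi> v y - (if y = v then c * C else 0)"
      using v by (simp add: \<pi>'_def sum.distrib sum_subtractf col[symmetric] sum_distrib_left
          sum_distrib_right mult_ac)
    then show "(\<Sum>x\<in>grid n. \<pi>' x y) = \<beta> y"
      using couplingsD(3)[OF \<pi> y] by (cases "y = v") (simp_all add: aC cC)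
  qed
  let ?d = torus_dist
  define A where "A = (\<Sum>y\<in>grid n. ?d v y * \<pi> v y)"
  define B where "B = (\<Sum>x\<in>grid n. ?d x v * \<pi> x v)"
  have "(\<Sum>x\<in>grid n. \<Sum>y\<in>grid n. ?d x y * (\<pi> x v * \<pi> v y))
      \<le> (\<Sum>x\<in>grid n. \<Sum>y\<in>grid n. (?d x v + ?d v y) * (\<pi> x v * \<pi> v y))"
    by (intro sum_mono mult_right_mono torus_dist_triangle[of _ n] mult_nonneg_nonneg nonneg)
       (use v in auto)
  also have "\<dots> = (\<Sum>x\<in>grid n. \<Sum>y\<in>grid n. (?d x v * \<pi> x v) * \<pi> v y)
                  + (\<Sum>x\<in>grid n. \<Sum>y\<in>grid n. \<pi> x v * (?d v y * \<pi> v y))"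
    by (simp add: sum.distrib algebra_simps)
  also have "\<dots> = B * R + C * A"
    by (simp only: sum_product[symmetric] row col A_def B_def)
  finally have tri: "(\<Sum>x\<in>grid n. \<Sum>y\<in>grid n. ?d x y * (\<pi> x v * \<pi> v y)) \<le> B * R + C * A" .
  have "transport_cost n \<pi>' = (\<Sum>x\<in>grid n. \<Sum>y\<in>grid n. ?d x y * \<pi> x y
      + a * (?d x y * (\<pi> x v * \<pi> v y))
      - (if x = v then b * (?d v y * \<pi> v y) else 0)
      - (if y = v then c * (?d x v * \<pi> x v) else 0))"
    unfolding transport_cost_def \<pi>'_def
    by (intro sum.cong refl) (auto simp: algebra_simps)
  also have "\<dots> = transport_cost n \<pi>
      + a * (\<Sum>x\<in>grid n. \<Sum>y\<in>grid n. ?d x y * (\<pi> x v * \<pi> v y))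
      - (\<Sum>x\<in>grid n. \<Sum>y\<in>grid n. if x = v then b * (?d v y * \<pi> v y) else 0)
      - (\<Sum>x\<in>grid n. \<Sum>y\<in>grid n. if y = v then c * (?d x v * \<pi> x v) else 0)"
    by (simp only: sum.distrib sum_subtractf sum_distrib_left[symmetric] transport_cost_def)
  also have "(\<Sum>x\<in>grid n. \<Sum>y\<in>grid n. if x = v then b * (?d v y * \<pi> v y) else 0) = b * A"
    by (subst sum.swap) (use v in \<open>simp add: A_def sum_distrib_left\<close>)
  also have "(\<Sum>x\<in>grid n. \<Sum>y\<in>grid n. if y = v then c * (?d x v * \<pi> x v) else 0) = c * B"
    using v by (simp add: B_def sum_distrib_left)
  finally have "transport_cost n \<pi>' = transport_cost n \<pi>
      + a * (\<Sum>x\<in>grid n. \<Sum>y\<in>grid n. ?d x y * (\<pi> x v * \<pi> v y)) - b * A - c * B" .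
  also have "\<dots> \<le> transport_cost n \<pi> + a * (B * R + C * A) - b * A - c * B"
    using mult_left_mono[OF tri a] by simp
  also have "a * (B * R + C * A) = c * B + b * A"
    unfolding aR[symmetric] aC[symmetric] by (simp add: algebra_simps)
  finally show "transport_cost n \<pi>' \<le> transport_cost n \<pi>" by simp
qed

text \<open>Mass that stays at \<open>v\<close> costs nothing and is removed first. If that does not use up \<open>t\<close>, then
  nothing stays at \<open>v\<close> any more and the rest can be cancelled by shortcutting.\<close>

lemma coupling_cancel_point:
  assumes v: "v \<in> grid n" and t: "t \<ge> 0"
    and \<alpha>: "0 \<le> \<alpha> v" and \<beta>: "0 \<le> \<beta> v"
    and \<pi>: "\<pi> \<in> couplings n (\<lambda>x. \<alpha> x + (if x = v then t else 0)) (\<lambda>x. \<beta> x + (if x = v then t else 0))"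
  obtains \<pi>' where "\<pi>' \<in> couplings n \<alpha> \<beta>" "transport_cost n \<pi>' \<le> transport_cost n \<pi>"
proof -
  define s where "s = min t (\<pi> v v)"
  define \<pi>0 where "\<pi>0 x y = \<pi> x y - (if x = v then if y = v then s else 0 else 0)" for x y
  have "s \<le> \<pi> v v" by (simp add: s_def)
  have \<pi>0: "\<pi>0 \<in> couplings n (\<lambda>x. \<alpha> x + (if x = v then t - s else 0))
                              (\<lambda>x. \<beta> x + (if x = v then t - s else 0))"
  proof (rule couplingsI)
    show "(\<Sum>y\<in>grid n. \<pi>0 x y) = \<alpha> x + (if x = v then t - s else 0)" if "x \<in> grid n" for x
      using couplingsD(2)[OF \<pi> that] v by (auto simp: \<pi>0_def sum_subtractf)
    show "(\<Sum>x\<in>grid n. \<pi>0 x y) = \<beta> y + (if y = v then t - s else 0)" if "y \<in> grid n" for y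
      using couplingsD(3)[OF \<pi> that] v by (auto simp: \<pi>0_def sum_subtractf)
  qed (use couplingsD(1)[OF \<pi>] \<open>s \<le> \<pi> v v\<close> in \<open>auto simp: \<pi>0_def\<close>)
  have cost: "transport_cost n \<pi>0 = transport_cost n \<pi>"
    unfolding transport_cost_def \<pi>0_def by (intro sum.cong refl) auto
  show thesis
  proof (cases "t \<le> \<pi> v v")
    case True
    then have "t - s = 0" by (simp add: s_def)
    with \<pi>0 have "\<pi>0 \<in> couplings n \<alpha> \<beta>" by (simp cong: if_cong)
    then show thesis using cost that by simp
  next
    case False
    then have "\<pi>0 v v = 0" "t - s > 0" by (auto simp: s_def \<pi>0_def)
    from coupling_shortcut[OF v this(2) \<alpha> \<beta> \<pi>0 this(1)] show thesis
      using cost that by metis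
  qed
qed

text \<open>The common mass \<open>\<gamma>\<close> is removed pixel by pixel; the set \<open>S\<close> of pixels still to be treated is what
  the induction runs over.\<close>

lemma coupling_cancel:
  assumes S: "finite S" "S \<subseteq> grid n"
    and \<alpha>: "\<And>x. x \<in> grid n \<Longrightarrow> 0 \<le> \<alpha> x" and \<beta>: "\<And>x. x \<in> grid n \<Longrightarrow> 0 \<le> \<beta> x"
    and \<gamma>: "\<And>x. x \<in> grid n \<Longrightarrow> 0 \<le> \<gamma> x"
    and \<pi>: "\<pi> \<in> couplings n (\<lambda>x. \<alpha> x + (if x \<in> S then \<gamma> x else 0)) (\<lambda>x. \<beta> x + (if x \<in> S then \<gamma> x else 0))"
  shows "\<exists>\<pi>'\<in>couplings n \<alpha> \<beta>. transport_cost n \<pi>' \<le> transport_cost n \<pi>"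
  using S \<pi>
proof (induction S arbitrary: \<pi> rule: finite_induct)
  case empty
  then show ?case by auto
next
  case (insert v S)
  let ?\<alpha> = "\<lambda>x. \<alpha> x + (if x \<in> S then \<gamma> x else 0)"
  let ?\<beta> = "\<lambda>x. \<beta> x + (if x \<in> S then \<gamma> x else 0)"
  have split: "f x + (if x \<in> insert v S then \<gamma> x else 0)
      = f x + (if x \<in> S then \<gamma> x else 0) + (if x = v then \<gamma> v else 0)" for f :: "_ \<Rightarrow> real" and x
    using insert.hyps by auto
  have v: "v \<in> grid n" using insert.prems by auto
  have "\<pi> \<in> couplings n (\<lambda>x. ?\<alpha> x + (if x = v then \<gamma> v else 0)) (\<lambda>x. ?\<beta> x + (if x = v then \<gamma> v else 0))"
    using insert.prems(2) unfolding split .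
  from coupling_cancel_point[OF v \<gamma>[OF v] _ _ this]
  obtain \<pi>1 where "\<pi>1 \<in> couplings n ?\<alpha> ?\<beta>" "transport_cost n \<pi>1 \<le> transport_cost n \<pi>"
    using \<alpha>[OF v] \<beta>[OF v] insert.hyps by auto
  moreover from this(1) insert.prems(1) have "\<exists>\<pi>'\<in>couplings n \<alpha> \<beta>. transport_cost n \<pi>' \<le> transport_cost n \<pi>1"
    by (intro insert.IH) auto
  ultimately show ?case using order_trans by blast
qed

lemma wasserstein_1_cancel:
  assumes \<alpha>: "\<And>x. x \<in> grid n \<Longrightarrow> 0 \<le> \<alpha> x" and \<beta>: "\<And>x. x \<in> grid n \<Longrightarrow> 0 \<le> \<beta> x"
    and \<gamma>: "\<And>x. x \<in> grid n \<Longrightarrow> 0 \<le> \<gamma> x" and mass: "sum \<alpha> (grid n) = sum \<beta> (grid n)"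
  shows "wasserstein 1 n (\<lambda>x. \<alpha> x + \<gamma> x) (\<lambda>x. \<beta> x + \<gamma> x) = wasserstein 1 n \<alpha> \<beta>"
proof (rule antisym)
  have ne: "couplings n \<alpha> \<beta> \<noteq> {}" using \<alpha> \<beta> mass by (rule couplings_nonempty)
  have "(\<lambda>x y. if x = y then \<gamma> x else 0) \<in> couplings n \<gamma> \<gamma>"
    by (rule couplingsI) (use \<gamma> in auto)
  moreover have "transport_cost n (\<lambda>x y. if x = y then \<gamma> x else 0) = 0"
    by (auto simp: transport_cost_def intro!: sum.neutral)
  ultimately have "couplings n \<gamma> \<gamma> \<noteq> {}" "wasserstein 1 n \<gamma> \<gamma> \<le> 0"
    using wasserstein_1_le[of _ n \<gamma> \<gamma>] by force+
  then show "wasserstein 1 n (\<lambda>x. \<alpha> x + \<gamma> x) (\<lambda>x. \<beta> x + \<gamma> x) \<le> wasserstein 1 n \<alpha> \<beta>"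
    using wasserstein_1_add[OF ne, of \<gamma> \<gamma>] by simp
  show "wasserstein 1 n \<alpha> \<beta> \<le> wasserstein 1 n (\<lambda>x. \<alpha> x + \<gamma> x) (\<lambda>x. \<beta> x + \<gamma> x)"
  proof (rule wasserstein_1_greatest)
    show "couplings n (\<lambda>x. \<alpha> x + \<gamma> x) (\<lambda>x. \<beta> x + \<gamma> x) \<noteq> {}"
      using assms by (intro couplings_nonempty) (auto simp: sum.distrib)
    fix \<pi> assume "\<pi> \<in> couplings n (\<lambda>x. \<alpha> x + \<gamma> x) (\<lambda>x. \<beta> x + \<gamma> x)"
    also have "couplings n (\<lambda>x. \<alpha> x + \<gamma> x) (\<lambda>x. \<beta> x + \<gamma> x)
        = couplings n (\<lambda>x. \<alpha> x + (if x \<in> grid n then \<gamma> x else 0))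
                      (\<lambda>x. \<beta> x + (if x \<in> grid n then \<gamma> x else 0))"
      by (rule couplings_cong) auto
    finally have "\<exists>\<pi>'\<in>couplings n \<alpha> \<beta>. transport_cost n \<pi>' \<le> transport_cost n \<pi>"
      by (intro coupling_cancel[of "grid n"]) (use \<alpha> \<beta> \<gamma> in auto)
    then show "wasserstein 1 n \<alpha> \<beta> \<le> transport_cost n \<pi>"
      using wasserstein_1_le order_trans by blast
  qed
qed

section \<open>The Kantorovich norm of a zero-sum measure\<close>

definition kantorovich_norm :: "nat \<Rightarrow> (real \<times> real \<Rightarrow> real) \<Rightarrow> real" where
  "kantorovich_norm n \<delta> = wasserstein 1 n (\<lambda>x. max (\<delta> x) 0) (\<lambda>x. max (- \<delta> x) 0)"

lemma sum_pos_part_eq_neg_part: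
  fixes \<delta> :: "'b \<Rightarrow> real"
  assumes "sum \<delta> A = 0"
  shows "(\<Sum>x\<in>A. max (\<delta> x) 0) = (\<Sum>x\<in>A. max (- \<delta> x) 0)"
proof -
  have "(\<Sum>x\<in>A. max (\<delta> x) 0) - (\<Sum>x\<in>A. max (- \<delta> x) 0) = sum \<delta> A"
    unfolding sum_subtractf[symmetric] by (intro sum.cong refl) auto
  with assms show ?thesis by simp
qed

text \<open>Adding \<open>\<beta>\<close> to the positive and negative parts of \<open>\<alpha> - \<beta>\<close> gives the same pair of measures
  as adding the negative part to \<open>\<alpha>\<close> and \<open>\<beta>\<close>, so the claim is cancellation applied twice.\<close>

lemma wasserstein_1_eq_kantorovich_norm:
  assumes \<alpha>: "\<And>x. x \<in> grid n \<Longrightarrow> 0 \<le> \<alpha> x" and \<beta>: "\<And>x. x \<in> grid n \<Longrightarrow> 0 \<le> \<beta> x"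
    and mass: "sum \<alpha> (grid n) = sum \<beta> (grid n)"
  shows "wasserstein 1 n \<alpha> \<beta> = kantorovich_norm n (\<lambda>x. \<alpha> x - \<beta> x)"
proof -
  let ?p = "\<lambda>x. max (\<alpha> x - \<beta> x) 0" and ?m = "\<lambda>x. max (- (\<alpha> x - \<beta> x)) 0"
  have "sum ?p (grid n) = sum ?m (grid n)"
    using mass by (intro sum_pos_part_eq_neg_part) (simp add: sum_subtractf)
  then have "wasserstein 1 n ?p ?m = wasserstein 1 n (\<lambda>x. ?p x + \<beta> x) (\<lambda>x. ?m x + \<beta> x)"
    by (intro wasserstein_1_cancel[symmetric] \<beta>) auto
  also have "\<dots> = wasserstein 1 n (\<lambda>x. \<alpha> x + ?m x) (\<lambda>x. \<beta> x + ?m x)"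
    by (intro wasserstein_1_cong) auto
  also have "\<dots> = wasserstein 1 n \<alpha> \<beta>"
    by (intro wasserstein_1_cancel \<alpha> \<beta> mass) auto
  finally show ?thesis by (simp add: kantorovich_norm_def)
qed

lemma signed_wasserstein_1_eq_kantorovich_norm:
  assumes "sum \<rho> (grid n) = sum \<tau> (grid n)"
  shows "signed_wasserstein 1 n \<rho> \<tau> = kantorovich_norm n (\<lambda>x. \<rho> x - \<tau> x)"
proof -
  let ?\<alpha> = "\<lambda>x. max (\<rho> x) 0 + max (- \<tau> x) 0" and ?\<beta> = "\<lambda>x. max (\<tau> x) 0 + max (- \<rho> x) 0"
  have diff: "?\<alpha> x - ?\<beta> x = \<rho> x - \<tau> x" for x by auto
  have "sum ?\<alpha> (grid n) - sum ?\<beta> (grid n) = 0"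
    unfolding sum_subtractf[symmetric] diff using assms by (simp add: sum_subtractf)
  then have "wasserstein 1 n ?\<alpha> ?\<beta> = kantorovich_norm n (\<lambda>x. ?\<alpha> x - ?\<beta> x)"
    by (intro wasserstein_1_eq_kantorovich_norm) auto
  then show ?thesis unfolding signed_wasserstein_def diff .
qed

text \<open>The exceptional value on the null event that the masses differ is a constant, so it does not
  spoil measurability.\<close>

lemma signed_wasserstein_1_unequal_mass:
  assumes "sum \<rho> (grid n) \<noteq> sum \<tau> (grid n)"
  shows "signed_wasserstein 1 n \<rho> \<tau> = Inf {}"
proof -
  let ?\<alpha> = "\<lambda>x. max (\<rho> x) 0 + max (- \<tau> x) 0" and ?\<beta> = "\<lambda>x. max (\<tau> x) 0 + max (- \<rho> x) 0"
  have diff: "?\<alpha> x - ?\<beta> x = \<rho> x - \<tau> x" for x by auto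
  have "sum ?\<alpha> (grid n) - sum ?\<beta> (grid n) \<noteq> 0"
    unfolding sum_subtractf[symmetric] diff using assms by (simp add: sum_subtractf)
  then have "couplings n ?\<alpha> ?\<beta> = {}" using couplings_equal_mass[of _ n ?\<alpha> ?\<beta>] by force
  then show ?thesis unfolding signed_wasserstein_def wasserstein_1 by simp
qed

lemma kantorovich_norm_cong:
  "(\<And>x. x \<in> grid n \<Longrightarrow> \<delta> x = \<delta>' x) \<Longrightarrow> kantorovich_norm n \<delta> = kantorovich_norm n \<delta>'"
  unfolding kantorovich_norm_def by (rule wasserstein_1_cong) auto

lemma kantorovich_norm_uminus: "kantorovich_norm n (\<lambda>x. - \<delta> x) = kantorovich_norm n \<delta>"
  unfolding kantorovich_norm_def by (subst wasserstein_1_commute) simp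

lemma kantorovich_norm_add:
  assumes "sum \<delta> (grid n) = 0" "sum \<delta>' (grid n) = 0"
  shows "kantorovich_norm n (\<lambda>x. \<delta> x + \<delta>' x) \<le> kantorovich_norm n \<delta> + kantorovich_norm n \<delta>'"
proof -
  let ?p = "\<lambda>\<delta> x. max (\<delta> x :: real) 0" and ?m = "\<lambda>\<delta> x. max (- \<delta> x :: real) 0"
  note mass = sum_pos_part_eq_neg_part[OF assms(1)] sum_pos_part_eq_neg_part[OF assms(2)]
  have "kantorovich_norm n (\<lambda>x. \<delta> x + \<delta>' x)
      = kantorovich_norm n (\<lambda>x. (?p \<delta> x + ?p \<delta>' x) - (?m \<delta> x + ?m \<delta>' x))"
    by (intro kantorovich_norm_cong) auto
  also have "\<dots> = wasserstein 1 n (\<lambda>x. ?p \<delta> x + ?p \<delta>' x) (\<lambda>x. ?m \<delta> x + ?m \<delta>' x)"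
    using mass by (intro wasserstein_1_eq_kantorovich_norm[symmetric]) (auto simp: sum.distrib)
  also have "\<dots> \<le> kantorovich_norm n \<delta> + kantorovich_norm n \<delta>'"
    unfolding kantorovich_norm_def
    by (intro wasserstein_1_add couplings_nonempty) (use mass in auto)
  finally show ?thesis .
qed

lemma kantorovich_norm_diff_le:
  assumes "sum \<delta> (grid n) = 0" "sum \<delta>' (grid n) = 0"
  shows "\<bar>kantorovich_norm n \<delta> - kantorovich_norm n \<delta>'\<bar> \<le> kantorovich_norm n (\<lambda>x. \<delta> x - \<delta>' x)"
proof -
  let ?\<gamma> = "\<lambda>x. \<delta> x - \<delta>' x"
  have \<gamma>: "sum ?\<gamma> (grid n) = 0" "sum (\<lambda>x. - ?\<gamma> x) (grid n) = 0"
    using assms by (simp_all add: sum_subtractf)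
  from kantorovich_norm_add[OF assms(2) \<gamma>(1)] kantorovich_norm_add[OF assms(1) \<gamma>(2)]
  show ?thesis unfolding kantorovich_norm_uminus by simp
qed

definition dipole :: "'b \<Rightarrow> 'b \<Rightarrow> 'b \<Rightarrow> real" where
  "dipole a b z = (if z = a then 1 else 0) - (if z = b then 1 else 0)"

lemma sum_dipole: "a \<in> grid n \<Longrightarrow> b \<in> grid n \<Longrightarrow> sum (dipole a b) (grid n) = 0"
  by (simp add: dipole_def[abs_def] sum_subtractf)

lemma dipole_telescope: "(\<Sum>i<k. dipole (f i) (f (Suc i)) z) = dipole (f 0) (f k) z"
  by (induction k) (simp_all add: dipole_def)

lemma dipole_expansion:
  assumes "z \<in> grid n"
  shows "(\<Sum>x\<in>grid n. \<delta> x * dipole x b z) = \<delta> z - (if z = b then sum \<delta> (grid n) else 0)"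
proof -
  have "(\<Sum>x\<in>grid n. \<delta> x * dipole x b z) = (\<Sum>x\<in>grid n. if x = z then \<delta> x else 0)
      - (\<Sum>x\<in>grid n. if z = b then \<delta> x else 0)"
    unfolding sum_subtractf[symmetric] by (intro sum.cong refl) (auto simp: dipole_def)
  then show ?thesis using assms by simp
qed

lemma kantorovich_norm_dipole:
  assumes "a \<in> grid n" "b \<in> grid n"
  shows "kantorovich_norm n (\<lambda>z. m * dipole a b z) \<le> \<bar>m\<bar> * torus_dist a b"
proof -
  have pos: "kantorovich_norm n (\<lambda>z. m * dipole a b z) \<le> m * torus_dist a b"
    if "m \<ge> 0" "a \<in> grid n" "b \<in> grid n" for m a b
  proof -
    let ?e = "\<lambda>a z. if z = a then m else 0" and ?\<pi> = "\<lambda>x y. if x = a then if y = b then m else 0 else 0"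
    have "kantorovich_norm n (\<lambda>z. m * dipole a b z) = kantorovich_norm n (\<lambda>z. ?e a z - ?e b z)"
      by (intro kantorovich_norm_cong) (auto simp: dipole_def)
    also have "\<dots> = wasserstein 1 n (?e a) (?e b)"
      using that by (intro wasserstein_1_eq_kantorovich_norm[symmetric]) auto
    also have "\<dots> \<le> transport_cost n ?\<pi>"
      by (intro wasserstein_1_le couplingsI) (use that in auto)
    also have "\<dots> = (\<Sum>x\<in>grid n. if x = a then torus_dist a b * m else 0)"
      unfolding transport_cost_def
      by (intro sum.cong refl) (use that in \<open>auto simp: if_distrib[of "\<lambda>u. _ * u"] cong: if_cong\<close>)
    also have "\<dots> = m * torus_dist a b" using that by simp
    finally show ?thesis .
  qed
  show ?thesis
  proof (cases "m \<ge> 0")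
    case True
    then show ?thesis using pos assms by simp
  next
    case False
    have "(\<lambda>z. m * dipole a b z) = (\<lambda>z. - m * dipole b a z)"
      by (simp add: dipole_def algebra_simps)
    then show ?thesis using pos[of "- m" b a] assms False by (simp add: torus_dist_commute)
  qed
qed

text \<open>Every way of writing a zero-sum measure as a combination of dipoles bounds its norm. Both the
  dyadic bound and the Lipschitz bound are instances.\<close>

lemma kantorovich_norm_sum_dipoles:
  assumes "finite I" "\<And>i. i \<in> I \<Longrightarrow> a i \<in> grid n" "\<And>i. i \<in> I \<Longrightarrow> b i \<in> grid n"
  shows "kantorovich_norm n (\<lambda>z. \<Sum>i\<in>I. m i * dipole (a i) (b i) z)
           \<le> (\<Sum>i\<in>I. \<bar>m i\<bar> * torus_dist (a i) (b i))"
  using assms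
proof (induction I rule: finite_induct)
  case empty
  have "(\<lambda>x y. 0) \<in> couplings n (\<lambda>x. max 0 0) (\<lambda>x. max (- 0) 0)"
    by (rule couplingsI) auto
  from wasserstein_1_le[OF this] show ?case
    by (simp add: kantorovich_norm_def transport_cost_def)
next
  case (insert j I)
  let ?\<delta> = "\<lambda>z. \<Sum>i\<in>I. m i * dipole (a i) (b i) z"
  have "sum ?\<delta> (grid n) = (\<Sum>i\<in>I. m i * sum (dipole (a i) (b i)) (grid n))"
    by (subst sum.swap) (simp add: sum_distrib_left)
  also have "\<dots> = 0" using insert.prems by (intro sum.neutral) (simp add: sum_dipole)
  finally have \<delta>: "sum ?\<delta> (grid n) = 0" .
  have j: "(\<Sum>z\<in>grid n. m j * dipole (a j) (b j) z) = 0"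
    using insert.prems by (simp add: sum_distrib_left[symmetric] sum_dipole)
  have "kantorovich_norm n (\<lambda>z. \<Sum>i\<in>insert j I. m i * dipole (a i) (b i) z)
      = kantorovich_norm n (\<lambda>z. m j * dipole (a j) (b j) z + ?\<delta> z)"
    using insert.hyps by simp
  also have "\<dots> \<le> kantorovich_norm n (\<lambda>z. m j * dipole (a j) (b j) z) + kantorovich_norm n ?\<delta>"
    by (rule kantorovich_norm_add[OF j \<delta>])
  also have "\<dots> \<le> \<bar>m j\<bar> * torus_dist (a j) (b j) + (\<Sum>i\<in>I. \<bar>m i\<bar> * torus_dist (a i) (b i))"
    using insert by (intro add_mono kantorovich_norm_dipole insert.IH) auto
  finally show ?case using insert.hyps by simp
qed

section \<open>Transport along the dyadic tree\<close>

definition grid_point :: "nat \<Rightarrow> nat \<times> nat \<Rightarrow> real \<times> real" where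
  "grid_point n p = (real (fst p) / real n, real (snd p) / real n)"

text \<open>The grid points are indexed by pairs of integers. The cells of level \<open>i\<close> are the squares of side
  \<open>2\<^sup>i\<close>, again indexed by pairs of integers, so that the parent of a cell \<open>c\<close> has the
  index \<open>cell 1 c\<close>.\<close>

definition cell :: "nat \<Rightarrow> nat \<times> nat \<Rightarrow> nat \<times> nat" where
  "cell i p = (fst p div 2 ^ i, snd p div 2 ^ i)"

definition corner :: "nat \<Rightarrow> nat \<times> nat \<Rightarrow> nat \<times> nat" where
  "corner i c = (2 ^ i * fst c, 2 ^ i * snd c)"

definition cell_points :: "nat \<Rightarrow> nat \<Rightarrow> nat \<times> nat \<Rightarrow> (real \<times> real) set" where
  "cell_points n i c = grid_point n ` {p \<in> {..<n} \<times> {..<n}. cell i p = c}"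

text \<open>An upper bound for the cost of sending the mass of each cell from its corner to the corner of
  its parent.\<close>

definition tree_cost :: "nat \<Rightarrow> (real \<times> real \<Rightarrow> real) \<Rightarrow> real" where
  "tree_cost \<eta> \<delta> = (\<Sum>i<\<eta>. \<Sum>c\<in>{..<2 ^ (\<eta> - i)} \<times> {..<2 ^ (\<eta> - i)}.
      \<bar>sum \<delta> (cell_points (2 ^ \<eta>) i c)\<bar> * (sqrt 2 * 2 ^ i / 2 ^ \<eta>))"

lemma grid_eq_grid_point: "grid n = grid_point n ` ({..<n} \<times> {..<n})"
  by (force simp: grid_def grid_point_def)

lemma inj_grid_point: "n > 0 \<Longrightarrow> inj (grid_point n)"
  by (auto simp: inj_def grid_point_def prod_eq_iff)

lemma grid_point_in_grid: "fst p < n \<Longrightarrow> snd p < n \<Longrightarrow> grid_point n p \<in> grid n"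
  by (cases p) (auto simp: grid_eq_grid_point)

lemma cell_Suc: "cell (Suc i) p = cell 1 (cell i p)"
  by (simp add: cell_def div_mult2_eq[symmetric] mult.commute)

lemma cell_in_range:
  assumes "p \<in> {..<2 ^ \<eta>} \<times> {..<2 ^ \<eta>}" "i \<le> \<eta>"
  shows "cell i p \<in> {..<2 ^ (\<eta> - i)} \<times> {..<2 ^ (\<eta> - i)}"
  using assms by (auto simp: cell_def less_mult_imp_div_less power_add[symmetric])

lemma corner_less:
  assumes "c \<in> {..<2 ^ (\<eta> - i)} \<times> {..<2 ^ (\<eta> - i)}" "i \<le> \<eta>"
  shows "fst (corner i c) < 2 ^ \<eta>" "snd (corner i c) < 2 ^ \<eta>"
proof -
  have "(2::nat) ^ \<eta> = 2 ^ i * 2 ^ (\<eta> - i)" using assms(2) by (simp add: power_add[symmetric])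
  then show "fst (corner i c) < 2 ^ \<eta>" "snd (corner i c) < 2 ^ \<eta>"
    using assms(1) by (auto simp: corner_def)
qed

lemma torus_dist_le_euclidean:
  assumes "x \<in> grid n" "y \<in> grid n" "\<bar>fst x - fst y\<bar> \<le> h" "\<bar>snd x - snd y\<bar> \<le> h"
  shows "torus_dist x y \<le> sqrt 2 * h"
proof -
  have "torus_dist x y \<le> sqrt (h\<^sup>2 + h\<^sup>2)"
    unfolding torus_dist_def
    by (intro real_sqrt_le_mono add_mono power_mono)
       (use assms grid_coords[OF assms(1)] grid_coords[OF assms(2)] in auto)
  also have "\<dots> = sqrt 2 * h"
    using assms(3) by (simp add: real_sqrt_mult)
  finally show ?thesis .
qed

text \<open>Passing to the parent clears the last binary digit of the cell index, so each coordinate moves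
  by \<open>0\<close> or \<open>2\<^sup>i\<close> pixels.\<close>

lemma torus_dist_parent_corner:
  assumes c: "c \<in> {..<2 ^ (\<eta> - i)} \<times> {..<2 ^ (\<eta> - i)}" and i: "i < \<eta>"
  shows "grid_point (2 ^ \<eta>) (corner i c) \<in> grid (2 ^ \<eta>)"
    and "grid_point (2 ^ \<eta>) (corner (Suc i) (cell 1 c)) \<in> grid (2 ^ \<eta>)"
    and "torus_dist (grid_point (2 ^ \<eta>) (corner i c)) (grid_point (2 ^ \<eta>) (corner (Suc i) (cell 1 c)))
           \<le> sqrt 2 * 2 ^ i / 2 ^ \<eta>"
proof -
  show g: "grid_point (2 ^ \<eta>) (corner i c) \<in> grid (2 ^ \<eta>)"
    using corner_less[OF c] i by (intro grid_point_in_grid) auto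
  have "cell 1 c \<in> {..<2 ^ (\<eta> - Suc i)} \<times> {..<2 ^ (\<eta> - Suc i)}"
    using cell_in_range[OF c, of 1] i by simp
  from corner_less[OF this] show g': "grid_point (2 ^ \<eta>) (corner (Suc i) (cell 1 c)) \<in> grid (2 ^ \<eta>)"
    using i by (intro grid_point_in_grid) auto
  have gap: "\<bar>real (2 ^ i * k) / real (2 ^ \<eta>) - real (2 ^ Suc i * (k div 2)) / real (2 ^ \<eta>)\<bar>
      \<le> 2 ^ i / 2 ^ \<eta>" for k :: nat
  proof -
    have "real k = 2 * real (k div 2) + real (k mod 2)"
      by (metis mult_div_mod_eq of_nat_add of_nat_mult of_nat_numeral)
    then have "real (2 ^ i * k) / real (2 ^ \<eta>) - real (2 ^ Suc i * (k div 2)) / real (2 ^ \<eta>)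
        = 2 ^ i / 2 ^ \<eta> * real (k mod 2)"
      by (simp add: field_simps)
    moreover have "real (k mod 2) \<le> 1" by simp
    ultimately show ?thesis by (simp add: mult_left_le divide_right_mono)
  qed
  show "torus_dist (grid_point (2 ^ \<eta>) (corner i c)) (grid_point (2 ^ \<eta>) (corner (Suc i) (cell 1 c)))
      \<le> sqrt 2 * 2 ^ i / 2 ^ \<eta>"
    using torus_dist_le_euclidean[OF g g', of "2 ^ i / 2 ^ \<eta>"] gap
    by (simp add: grid_point_def corner_def cell_def)
qed

text \<open>The mass at a pixel \<open>p\<close> travels along the corners of the cells that contain \<open>p\<close>, from \<open>p\<close> to the
  origin, where the total mass zero makes everything cancel. The steps of all pixels of a cell coincide
  and are carried out together, so that only the net mass of the cell has to be moved.\<close>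

lemma kantorovich_norm_le_tree_cost:
  assumes zero: "sum \<delta> (grid (2 ^ \<eta>)) = 0"
  shows "kantorovich_norm (2 ^ \<eta>) \<delta> \<le> tree_cost \<eta> \<delta>"
proof -
  define n :: nat where "n = 2 ^ \<eta>"
  define I where "I = {..<n} \<times> {..<n}"
  define K where "K i = {..<(2::nat) ^ (\<eta> - i)} \<times> {..<(2::nat) ^ (\<eta> - i)}" for i
  define P where "P = Sigma {..<\<eta>} K"
  define m where "m q = sum \<delta> (cell_points n (fst q) (snd q))" for q
  define a where "a q = grid_point n (corner (fst q) (snd q))" for q
  define b where "b q = grid_point n (corner (Suc (fst q)) (cell 1 (snd q)))" for q
  have inj: "inj (grid_point n)" by (rule inj_grid_point) (simp add: n_def)
  have fin: "finite I" "finite (K i)" for i by (simp_all add: I_def K_def)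
  have "\<delta> z = (\<Sum>q\<in>P. m q * dipole (a q) (b q) z)" if z: "z \<in> grid n" for z
  proof -
    \<comment> \<open>The path of the pixel \<open>p\<close> through the tree.\<close>
    define f where "f p i = grid_point n (corner i (cell i p))" for p i
    have f0: "f p 0 = grid_point n p" for p by (simp add: f_def corner_def cell_def)
    have f\<eta>: "f p \<eta> = grid_point n (0, 0)" if "p \<in> I" for p
      using that by (auto simp: f_def corner_def cell_def I_def n_def)
    have "\<delta> z = (\<Sum>x\<in>grid n. \<delta> x * dipole x (grid_point n (0, 0)) z)"
      using dipole_expansion[OF z] zero by (simp add: n_def)
    also have "\<dots> = (\<Sum>p\<in>I. \<delta> (grid_point n p) * dipole (grid_point n p) (grid_point n (0, 0)) z)"
      unfolding grid_eq_grid_point I_def using inj by (subst sum.reindex) (auto intro: inj_on_subset)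
    also have "\<dots> = (\<Sum>p\<in>I. \<Sum>i<\<eta>. \<delta> (grid_point n p) * dipole (f p i) (f p (Suc i)) z)"
      using f\<eta> by (intro sum.cong refl) (simp add: sum_distrib_left[symmetric] dipole_telescope f0)
    also have "\<dots> = (\<Sum>i<\<eta>. \<Sum>p\<in>I. \<delta> (grid_point n p) * dipole (f p i) (f p (Suc i)) z)"
      by (rule sum.swap)
    also have "\<dots> = (\<Sum>i<\<eta>. \<Sum>c\<in>K i. m (i, c) * dipole (a (i, c)) (b (i, c)) z)"
    proof (rule sum.cong[OF refl])
      fix i assume "i \<in> {..<\<eta>}"
      then have "i \<le> \<eta>" by simp
      then have sub: "cell i ` I \<subseteq> K i"
        unfolding I_def K_def n_def by (intro image_subsetI cell_in_range)
      have "(\<Sum>p\<in>I. \<delta> (grid_point n p) * dipole (f p i) (f p (Suc i)) z)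
          = (\<Sum>c\<in>K i. \<Sum>p\<in>{p \<in> I. cell i p = c}. \<delta> (grid_point n p) * dipole (f p i) (f p (Suc i)) z)"
        by (rule sum.group[OF fin(1) fin(2) sub, symmetric])
      also have "\<dots> = (\<Sum>c\<in>K i. \<Sum>p\<in>{p \<in> I. cell i p = c}.
          \<delta> (grid_point n p) * dipole (a (i, c)) (b (i, c)) z)"
        by (intro sum.cong refl) (auto simp: f_def a_def b_def cell_Suc[of i])
      also have "\<dots> = (\<Sum>c\<in>K i. m (i, c) * dipole (a (i, c)) (b (i, c)) z)"
      proof (rule sum.cong[OF refl])
        fix c
        have "m (i, c) = (\<Sum>p\<in>{p \<in> I. cell i p = c}. \<delta> (grid_point n p))"
          unfolding m_def cell_points_def I_def fst_conv snd_conv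
          using inj by (subst sum.reindex) (auto intro: inj_on_subset)
        then show "(\<Sum>p\<in>{p \<in> I. cell i p = c}. \<delta> (grid_point n p) * dipole (a (i, c)) (b (i, c)) z)
            = m (i, c) * dipole (a (i, c)) (b (i, c)) z"
          by (simp add: sum_distrib_right)
      qed
      finally show "(\<Sum>p\<in>I. \<delta> (grid_point n p) * dipole (f p i) (f p (Suc i)) z)
          = (\<Sum>c\<in>K i. m (i, c) * dipole (a (i, c)) (b (i, c)) z)" .
    qed
    also have "\<dots> = (\<Sum>q\<in>P. m q * dipole (a q) (b q) z)"
      unfolding P_def by (subst sum.Sigma) (auto simp: fin case_prod_unfold)
    finally show ?thesis .
  qed
  moreover have ab: "a q \<in> grid n" "b q \<in> grid n"
      "torus_dist (a q) (b q) \<le> sqrt 2 * 2 ^ fst q / 2 ^ \<eta>" if "q \<in> P" for q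
  proof -
    from that have "snd q \<in> K (fst q)" "fst q < \<eta>" by (auto simp: P_def)
    from torus_dist_parent_corner[OF this[unfolded K_def]]
    show "a q \<in> grid n" "b q \<in> grid n" "torus_dist (a q) (b q) \<le> sqrt 2 * 2 ^ fst q / 2 ^ \<eta>"
      unfolding a_def b_def n_def .
  qed
  ultimately have "kantorovich_norm n \<delta> = kantorovich_norm n (\<lambda>z. \<Sum>q\<in>P. m q * dipole (a q) (b q) z)"
    by (intro kantorovich_norm_cong)
  also have "\<dots> \<le> (\<Sum>q\<in>P. \<bar>m q\<bar> * torus_dist (a q) (b q))"
    by (intro kantorovich_norm_sum_dipoles ab) (simp add: P_def fin)
  also have "\<dots> \<le> (\<Sum>q\<in>P. \<bar>m q\<bar> * (sqrt 2 * 2 ^ fst q / 2 ^ \<eta>))"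
    by (intro sum_mono mult_left_mono ab) simp_all
  also have "\<dots> = tree_cost \<eta> \<delta>"
    unfolding tree_cost_def P_def K_def[symmetric] m_def n_def[symmetric]
    by (subst sum.Sigma) (auto simp: fin case_prod_unfold)
  finally show ?thesis by (simp add: n_def)
qed

lemma card_cell_points: "card (cell_points n i c) \<le> 2 ^ i * 2 ^ i"
proof -
  let ?J = "\<lambda>k. {2 ^ i * k..<2 ^ i * k + 2 ^ i} :: nat set"
  have J: "a \<in> ?J (a div 2 ^ i)" for a :: nat
  proof -
    have "a = 2 ^ i * (a div 2 ^ i) + a mod 2 ^ i" "a mod 2 ^ i < 2 ^ i" by simp_all
    then show ?thesis by (metis atLeastLessThan_iff le_add1 nat_add_left_cancel_less)
  qed
  have sub: "{p \<in> {..<n} \<times> {..<n}. cell i p = c} \<subseteq> ?J (fst c) \<times> ?J (snd c)"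
    using J by (auto simp: cell_def simp del: atLeastLessThan_iff)
  have "card (cell_points n i c) \<le> card {p \<in> {..<n} \<times> {..<n}. cell i p = c}"
    unfolding cell_points_def by (intro card_image_le finite_subset[OF sub]) simp
  also have "\<dots> \<le> card (?J (fst c) \<times> ?J (snd c))"
    using sub by (intro card_mono) auto
  finally show ?thesis by (simp add: card_cartesian_product)
qed

lemma cell_points_subset_grid: "cell_points n i c \<subseteq> grid n"
  by (auto simp: cell_points_def grid_eq_grid_point)

lemma tree_cost_diff_le: "tree_cost \<eta> (\<lambda>x. \<delta> x - \<delta>' x) \<le> tree_cost \<eta> \<delta> + tree_cost \<eta> \<delta>'"
proof -
  have key: "\<bar>sum (\<lambda>x. \<delta> x - \<delta>' x) S\<bar> * h \<le> \<bar>sum \<delta> S\<bar> * h + \<bar>sum \<delta>' S\<bar> * h" if "h \<ge> 0" for S h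
    using that unfolding distrib_right[symmetric] by (intro mult_right_mono) (auto simp: sum_subtractf)
  show ?thesis
    unfolding tree_cost_def sum.distrib[symmetric] by (intro sum_mono key) simp
qed

section \<open>Measurability\<close>

text \<open>A coordinatewise measurable map is Borel measurable into a countable product. Hence the
  coordinates in \<open>I\<close> are renumbered by natural numbers, which turns \<open>F\<close> into a continuous function
  on the space of real sequences.\<close>

lemma borel_measurable_lipschitz_coordinates:
  fixes F :: "('i \<Rightarrow> real) \<Rightarrow> real"
  assumes I: "finite I"
    and X: "\<And>i. i \<in> I \<Longrightarrow> (\<lambda>\<omega>. X \<omega> i) \<in> borel_measurable M"
    and lip: "\<And>u v. \<bar>F u - F v\<bar> \<le> C * (\<Sum>i\<in>I. \<bar>u i - v i\<bar>)"
  shows "(\<lambda>\<omega>. F (X \<omega>)) \<in> borel_measurable M"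
proof -
  define e where "e = to_nat_on I"
  define G where "G u = F (\<lambda>i. u (e i))" for u :: "nat \<Rightarrow> real"
  define Y where "Y \<omega> k = (if k \<in> e ` I then X \<omega> (from_nat_into I k) else 0)" for \<omega> k
  have inv: "from_nat_into I (e i) = i" if "i \<in> I" for i
    using that I by (simp add: e_def countable_finite)
  have "(\<lambda>\<omega>. Y \<omega> k) \<in> borel_measurable M" for k
    using X inv by (cases "k \<in> e ` I") (auto simp: Y_def)
  then have Y: "Y \<in> borel_measurable M" by (rule measurable_coordinatewise_then_product)
  have "isCont G v" for v
  proof -
    have coord: "((\<lambda>u. u k) \<longlongrightarrow> v k) (at v)" for k
      using continuous_on_product_coordinates[of k] unfolding continuous_on_def by blast
    have "((\<lambda>u. C * (\<Sum>i\<in>I. \<bar>u (e i) - v (e i)\<bar>)) \<longlongrightarrow> C * (\<Sum>i\<in>I. \<bar>v (e i) - v (e i)\<bar>)) (at v)"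
      by (intro tendsto_intros coord)
    then have lim: "((\<lambda>u. C * (\<Sum>i\<in>I. \<bar>u (e i) - v (e i)\<bar>)) \<longlongrightarrow> 0) (at v)" by simp
    have "((\<lambda>u. G u - G v) \<longlongrightarrow> 0) (at v)"
      by (rule Lim_null_comparison[OF _ lim]) (simp add: G_def lip)
    then show ?thesis by (simp add: isCont_def LIM_zero_iff)
  qed
  then have "G \<in> borel_measurable borel"
    by (intro borel_measurable_continuous_onI continuous_at_imp_continuous_on) auto
  with Y have "(\<lambda>\<omega>. G (Y \<omega>)) \<in> borel_measurable M" by (rule measurable_compose)
  moreover have "G (Y \<omega>) = F (X \<omega>)" for \<omega>
  proof -
    have "(\<Sum>i\<in>I. \<bar>Y \<omega> (e i) - X \<omega> i\<bar>) = 0"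
      by (intro sum.neutral) (auto simp: Y_def inv)
    then show ?thesis using lip[of "\<lambda>i. Y \<omega> (e i)" "X \<omega>"] by (simp add: G_def)
  qed
  ultimately show ?thesis by simp
qed

text \<open>The Lipschitz estimate concerns zero-sum measures. The norm is extended to all measures by
  putting the missing mass at one pixel \<open>b\<close>: a measure \<open>\<delta>\<close> is replaced by the sum of the dipoles from
  the pixels to \<open>b\<close> with weights \<open>\<delta>\<close>.\<close>

lemma kantorovich_norm_measurable:
  assumes n: "n > 0" and X: "\<And>x. x \<in> grid n \<Longrightarrow> (\<lambda>\<omega>. X \<omega> x) \<in> borel_measurable M"
  shows "(\<lambda>\<omega>. if sum (X \<omega>) (grid n) = 0 then kantorovich_norm n (X \<omega>) else c) \<in> borel_measurable M"
proof -
  define b where "b = grid_point n (0, 0)"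
  have b: "b \<in> grid n" using n by (simp add: b_def grid_point_in_grid)
  define centre where "centre \<delta> z = (\<Sum>x\<in>grid n. \<delta> x * dipole x b z)" for \<delta> z
  have sum_centre: "sum (centre \<delta>) (grid n) = 0" for \<delta>
    unfolding centre_def
    by (subst sum.swap) (auto simp: sum_distrib_left[symmetric] sum_dipole b intro!: sum.neutral)
  have "(\<lambda>\<omega>. kantorovich_norm n (centre (X \<omega>))) \<in> borel_measurable M"
  proof (rule borel_measurable_lipschitz_coordinates[OF finite_grid X])
    fix u v :: "real \<times> real \<Rightarrow> real"
    have "\<bar>kantorovich_norm n (centre u) - kantorovich_norm n (centre v)\<bar>
        \<le> kantorovich_norm n (\<lambda>z. centre u z - centre v z)"
      by (intro kantorovich_norm_diff_le sum_centre)
    also have "(\<lambda>z. centre u z - centre v z) = (\<lambda>z. \<Sum>x\<in>grid n. (u x - v x) * dipole x b z)"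
      by (simp add: centre_def sum_subtractf left_diff_distrib)
    also have "kantorovich_norm n \<dots> \<le> (\<Sum>x\<in>grid n. \<bar>u x - v x\<bar> * torus_dist x b)"
      by (rule kantorovich_norm_sum_dipoles) (use b in auto)
    also have "\<dots> \<le> (\<Sum>x\<in>grid n. \<bar>u x - v x\<bar> * (sqrt 2 * 1))"
    proof (intro sum_mono mult_left_mono)
      fix x assume x: "x \<in> grid n"
      show "torus_dist x b \<le> sqrt 2 * 1"
        using grid_coords[OF x] grid_coords[OF b] by (intro torus_dist_le_euclidean[OF x b]) auto
    qed simp
    finally show "\<bar>kantorovich_norm n (centre u) - kantorovich_norm n (centre v)\<bar>
        \<le> sqrt 2 * (\<Sum>x\<in>grid n. \<bar>u x - v x\<bar>)"
      by (simp add: sum_distrib_left mult.commute)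
  qed
  moreover have "(\<lambda>\<omega>. sum (X \<omega>) (grid n)) \<in> borel_measurable M"
    using X by (intro borel_measurable_sum)
  ultimately have "(\<lambda>\<omega>. if sum (X \<omega>) (grid n) = 0 then kantorovich_norm n (centre (X \<omega>)) else c)
      \<in> borel_measurable M"
    by measurable
  also have "(\<lambda>\<omega>. if sum (X \<omega>) (grid n) = 0 then kantorovich_norm n (centre (X \<omega>)) else c)
      = (\<lambda>\<omega>. if sum (X \<omega>) (grid n) = 0 then kantorovich_norm n (X \<omega>) else c)"
    by (auto simp: centre_def dipole_expansion fun_eq_iff intro!: kantorovich_norm_cong)
  finally show ?thesis .
qed

section \<open>Partial sums of the noise\<close>

lemma normal_law_abs_moment:
  assumes "v \<ge> 0"
  shows "has_bochner_integral (normal_law 0 v) (\<lambda>x. \<bar>x\<bar>) (sqrt v * sqrt (2 / pi))"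
proof (cases "v = 0")
  case True
  interpret prob_space "return borel (0::real)" by (rule prob_space_return) simp
  have "AE x in return borel (0::real). \<bar>x\<bar> = 0"
    by (subst AE_return) auto
  then have "has_bochner_integral (return borel (0::real)) (\<lambda>x. \<bar>x\<bar>) 0"
    by (subst has_bochner_integral_cong_AE[of _ _ "\<lambda>_. 0"]) auto
  then show ?thesis using True by (simp add: normal_law_def)
next
  case False
  have "has_bochner_integral lborel (\<lambda>x. normal_density 0 (sqrt v) x *\<^sub>R \<bar>x\<bar>) (sqrt v * sqrt (2 / pi))"
    using normal_moment_abs_odd[of "sqrt v" 0 0] False assms by simp
  then have "has_bochner_integral (density lborel (\<lambda>x. ennreal (normal_density 0 (sqrt v) x)))
      (\<lambda>x. \<bar>x\<bar>) (sqrt v * sqrt (2 / pi))"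
    by (intro has_bochner_integral_density) (use normal_density_nonneg in auto)
  then show ?thesis using False by (simp add: normal_law_def)
qed

lemma zero_sum_noise_measurable:
  "zero_sum_noise M n \<sigma> \<epsilon> \<Longrightarrow> x \<in> grid n \<Longrightarrow> (\<lambda>\<omega>. \<epsilon> \<omega> x) \<in> borel_measurable M"
  by (simp add: zero_sum_noise_def gaussian_vector_def)

text \<open>The linear combination in question has coefficients 1 on \<open>S\<close> and 0 elsewhere. For
  \<open>n > 1\<close> its variance vanishes if \<open>S\<close> is the whole grid, which is why the noise sums to zero.\<close>

lemma zero_sum_noise_subset_law:
  assumes noise: "zero_sum_noise M n \<sigma> \<epsilon>" and S: "S \<subseteq> grid n"
  shows "distr M borel (\<lambda>\<omega>. sum (\<epsilon> \<omega>) S)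
           = normal_law 0 (real (card S) * \<sigma>\<^sup>2 * (1 - (real (card S) - 1) / (real (n\<^sup>2) - 1)))"
proof -
  let ?t = "\<lambda>x. if x \<in> S then 1 else 0 :: real"
  define r where "r = \<sigma>\<^sup>2 / (real (n\<^sup>2) - 1)"
  have restr: "(\<Sum>x\<in>grid n. ?t x * f x) = sum f S" for f :: "real \<times> real \<Rightarrow> real"
    using S by (intro sum.mono_neutral_cong_right) auto
  have fin: "finite S" using S finite_grid by (rule finite_subset)
  have row: "(\<Sum>y\<in>S. zero_sum_cov n \<sigma> x y) = \<sigma>\<^sup>2 - (real (card S) - 1) * r" if "x \<in> S" for x
  proof -
    have "(\<Sum>y\<in>S. zero_sum_cov n \<sigma> x y) = (\<Sum>y\<in>S. (if x = y then \<sigma>\<^sup>2 + r else 0) - r)"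
      by (intro sum.cong refl) (simp add: zero_sum_cov_def r_def)
    also have "\<dots> = \<sigma>\<^sup>2 - (real (card S) - 1) * r"
      using that fin by (simp add: sum_subtractf algebra_simps)
    finally show ?thesis .
  qed
  have "(\<Sum>x\<in>grid n. \<Sum>y\<in>grid n. ?t x * zero_sum_cov n \<sigma> x y * ?t y)
      = (\<Sum>x\<in>grid n. ?t x * (\<Sum>y\<in>grid n. ?t y * zero_sum_cov n \<sigma> x y))"
    by (simp add: sum_distrib_left mult_ac)
  also have "\<dots> = (\<Sum>x\<in>S. \<sigma>\<^sup>2 - (real (card S) - 1) * r)"
    unfolding restr by (intro sum.cong refl row)
  also have "\<dots> = real (card S) * \<sigma>\<^sup>2 * (1 - (real (card S) - 1) / (real (n\<^sup>2) - 1))"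
    by (simp add: r_def algebra_simps)
  finally have var: "(\<Sum>x\<in>grid n. \<Sum>y\<in>grid n. ?t x * zero_sum_cov n \<sigma> x y * ?t y)
      = real (card S) * \<sigma>\<^sup>2 * (1 - (real (card S) - 1) / (real (n\<^sup>2) - 1))" .
  have "distr M borel (\<lambda>\<omega>. \<Sum>x\<in>grid n. ?t x * \<epsilon> \<omega> x)
      = normal_law (\<Sum>x\<in>grid n. ?t x * 0) (\<Sum>x\<in>grid n. \<Sum>y\<in>grid n. ?t x * zero_sum_cov n \<sigma> x y * ?t y)"
    by (rule spec[OF conjunct2[OF noise[unfolded zero_sum_noise_def gaussian_vector_def]], of ?t])
  then show ?thesis unfolding restr var by simp
qed

lemma card_grid: "n > 0 \<Longrightarrow> card (grid n) = n\<^sup>2"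
  unfolding grid_eq_grid_point
  by (subst card_image) (auto intro: inj_on_subset[OF inj_grid_point] simp: card_cartesian_product power2_eq_square)

lemma zero_sum_noise_sum_zero:
  assumes noise: "zero_sum_noise M n \<sigma> \<epsilon>" and n: "n > 1"
  shows "AE \<omega> in M. sum (\<epsilon> \<omega>) (grid n) = 0"
proof -
  have "real (n\<^sup>2) - 1 \<noteq> 0" using n by (simp add: power2_eq_1_iff)
  then have law: "distr M borel (\<lambda>\<omega>. sum (\<epsilon> \<omega>) (grid n)) = return borel 0"
    using zero_sum_noise_subset_law[OF noise subset_refl] card_grid[of n] n by (simp add: normal_law_def)
  have [measurable]: "(\<lambda>\<omega>. sum (\<epsilon> \<omega>) (grid n)) \<in> borel_measurable M"
    using zero_sum_noise_measurable[OF noise] by (intro borel_measurable_sum)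
  have "AE x in return borel (0::real). x = 0" by (subst AE_return) auto
  then have "AE x in distr M borel (\<lambda>\<omega>. sum (\<epsilon> \<omega>) (grid n)). x = 0"
    unfolding law .
  then show ?thesis by (subst (asm) AE_distr_iff) auto
qed

text \<open>The negative correlations can only decrease the variance of a sum, so independent noise of
  variance \<open>\<sigma>\<^sup>2\<close> is the worst case.\<close>

lemma zero_sum_noise_abs_sum:
  assumes noise: "zero_sum_noise M n \<sigma> \<epsilon>" and \<sigma>: "\<sigma> \<ge> 0" and n: "n > 1" and S: "S \<subseteq> grid n"
  shows "integrable M (\<lambda>\<omega>. \<bar>sum (\<epsilon> \<omega>) S\<bar>)"
    and "(\<integral>\<omega>. \<bar>sum (\<epsilon> \<omega>) S\<bar> \<partial>M) \<le> \<sigma> * sqrt (real (card S)) * sqrt (2 / pi)"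
proof -
  define v where "v = real (card S) * \<sigma>\<^sup>2 * (1 - (real (card S) - 1) / (real (n\<^sup>2) - 1))"
  have meas: "(\<lambda>\<omega>. sum (\<epsilon> \<omega>) S) \<in> borel_measurable M"
    using zero_sum_noise_measurable[OF noise] S by (intro borel_measurable_sum) auto
  have "card S \<le> n\<^sup>2" using card_mono[OF finite_grid S] card_grid[of n] n by simp
  then have cardS: "real (card S) \<le> real (n\<^sup>2)" by (simp only: of_nat_le_iff)
  have "1 < n\<^sup>2" using n by (intro one_less_power) auto
  then have "real 1 < real (n\<^sup>2)" by (simp only: of_nat_less_iff)
  then have m: "real (n\<^sup>2) - 1 > 0" by simp
  have "v \<ge> 0"
    unfolding v_def using cardS m by (intro mult_nonneg_nonneg) (auto simp: divide_le_eq)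
  have "v \<le> real (card S) * \<sigma>\<^sup>2 * 1"
  proof (cases "card S = 0")
    case False
    then show ?thesis unfolding v_def using m by (intro mult_left_mono) auto
  qed (simp add: v_def)
  then have "sqrt v \<le> \<sigma> * sqrt (real (card S))"
    using \<sigma> real_sqrt_le_mono[of v] by (fastforce simp: real_sqrt_mult mult.commute)
  have "has_bochner_integral (distr M borel (\<lambda>\<omega>. sum (\<epsilon> \<omega>) S)) (\<lambda>x. \<bar>x\<bar>) (sqrt v * sqrt (2 / pi))"
    unfolding zero_sum_noise_subset_law[OF noise S] v_def[symmetric]
    using \<open>v \<ge> 0\<close> by (rule normal_law_abs_moment)
  then have int: "integrable M (\<lambda>\<omega>. \<bar>sum (\<epsilon> \<omega>) S\<bar>)"
    and eq: "(\<integral>\<omega>. \<bar>sum (\<epsilon> \<omega>) S\<bar> \<partial>M) = sqrt v * sqrt (2 / pi)"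
    using meas by (simp_all add: has_bochner_integral_iff integrable_distr_eq integral_distr)
  show "integrable M (\<lambda>\<omega>. \<bar>sum (\<epsilon> \<omega>) S\<bar>)" by (rule int)
  show "(\<integral>\<omega>. \<bar>sum (\<epsilon> \<omega>) S\<bar> \<partial>M) \<le> \<sigma> * sqrt (real (card S)) * sqrt (2 / pi)"
    unfolding eq by (intro mult_right_mono) (use \<open>sqrt v \<le> _\<close> in auto)
qed

section \<open>The expected discrepancy\<close>

text \<open>A cell of side \<open>2\<^sup>i\<close> has mean absolute mass and distance to its parent both
  proportional to \<open>2\<^sup>i\<close>. The product \<open>4\<^sup>i\<close> is compensated exactly by the number
  of cells, and all levels contribute equally.\<close>

lemma expected_tree_cost:
  assumes noise: "zero_sum_noise M (2 ^ \<eta>) \<sigma> \<epsilon>" and \<sigma>: "\<sigma> \<ge> 0" and \<eta>: "\<eta> \<ge> 1"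
  shows "integrable M (\<lambda>\<omega>. tree_cost \<eta> (\<epsilon> \<omega>))"
    and "(\<integral>\<omega>. tree_cost \<eta> (\<epsilon> \<omega>) \<partial>M) \<le> 2 * 2 ^ \<eta> * real \<eta> / sqrt pi * \<sigma>"
proof -
  define K where "K i = {..<(2::nat) ^ (\<eta> - i)} \<times> {..<(2::nat) ^ (\<eta> - i)}" for i
  have n: "(2::nat) ^ \<eta> > 1" using \<eta> by (intro one_less_power) auto
  note abs = zero_sum_noise_abs_sum[OF noise \<sigma> n cell_points_subset_grid]
  show "integrable M (\<lambda>\<omega>. tree_cost \<eta> (\<epsilon> \<omega>))"
    unfolding tree_cost_def
    by (intro Bochner_Integration.integrable_sum integrable_mult_left abs)
  have "(\<integral>\<omega>. tree_cost \<eta> (\<epsilon> \<omega>) \<partial>M) = (\<Sum>i<\<eta>. \<Sum>c\<in>K i.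
      (\<integral>\<omega>. \<bar>sum (\<epsilon> \<omega>) (cell_points (2 ^ \<eta>) i c)\<bar> \<partial>M) * (sqrt 2 * 2 ^ i / 2 ^ \<eta>))"
    unfolding tree_cost_def K_def
    by (simp add: Bochner_Integration.integral_sum abs del: times_divide_eq_right)
  also have "\<dots> \<le> (\<Sum>i<\<eta>. \<Sum>c\<in>K i. (\<sigma> * 2 ^ i * sqrt (2 / pi)) * (sqrt 2 * 2 ^ i / 2 ^ \<eta>))"
  proof (intro sum_mono mult_right_mono)
    fix i c
    have "real (card (cell_points (2 ^ \<eta>) i c)) \<le> real (2 ^ i * 2 ^ i)"
      by (simp only: of_nat_le_iff card_cell_points)
    from real_sqrt_le_mono[OF this] have "sqrt (real (card (cell_points (2 ^ \<eta>) i c))) \<le> 2 ^ i"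
      by (simp add: real_sqrt_mult)
    then have "\<sigma> * sqrt (real (card (cell_points (2 ^ \<eta>) i c))) * sqrt (2 / pi) \<le> \<sigma> * 2 ^ i * sqrt (2 / pi)"
      using \<sigma> by (intro mult_right_mono mult_left_mono) auto
    with abs(2) show "(\<integral>\<omega>. \<bar>sum (\<epsilon> \<omega>) (cell_points (2 ^ \<eta>) i c)\<bar> \<partial>M) \<le> \<sigma> * 2 ^ i * sqrt (2 / pi)"
      by (rule order_trans)
  qed simp
  also have "\<dots> = (\<Sum>i<\<eta>. 2 * 2 ^ \<eta> / sqrt pi * \<sigma>)"
  proof (intro sum.cong refl)
    fix i assume "i \<in> {..<\<eta>}"
    then have card: "real (card (K i)) * 2 ^ i * 2 ^ i = 2 ^ \<eta> * 2 ^ \<eta>"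
      by (simp add: K_def card_cartesian_product power_add[symmetric] mult_ac)
    have "(\<Sum>c\<in>K i. (\<sigma> * 2 ^ i * sqrt (2 / pi)) * (sqrt 2 * 2 ^ i / 2 ^ \<eta>))
        = (real (card (K i)) * 2 ^ i * 2 ^ i) * (sqrt 2 * sqrt 2) / (2 ^ \<eta> * sqrt pi) * \<sigma>"
      by (simp add: real_sqrt_divide mult_ac del: real_sqrt_mult_self)
    then show "(\<Sum>c\<in>K i. (\<sigma> * 2 ^ i * sqrt (2 / pi)) * (sqrt 2 * 2 ^ i / 2 ^ \<eta>)) = 2 * 2 ^ \<eta> / sqrt pi * \<sigma>"
      unfolding card by simp
  qed
  also have "\<dots> = 2 * 2 ^ \<eta> * real \<eta> / sqrt pi * \<sigma>" by simp
  finally show "(\<integral>\<omega>. tree_cost \<eta> (\<epsilon> \<omega>) \<partial>M) \<le> 2 * 2 ^ \<eta> * real \<eta> / sqrt pi * \<sigma>" .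
qed

theorem theorem3p7:
  fixes M :: "'a measure"
    and \<eta> n :: nat
    and \<sigma> :: real
    and \<mu> \<nu> :: "real \<times> real \<Rightarrow> real"
    and \<epsilon>\<mu> \<epsilon>\<nu> :: "'a \<Rightarrow> real \<times> real \<Rightarrow> real"
  assumes "prob_space M"
    and "\<eta> \<ge> 1" and "n = 2 ^ \<eta>"
    and "\<sigma> > 0"
    and "prob_on_grid n \<mu>" and "prob_on_grid n \<nu>"
    and "zero_sum_noise M n \<sigma> \<epsilon>\<mu>" and "zero_sum_noise M n \<sigma> \<epsilon>\<nu>"
    and "prob_space.indep_var M
           (Pi\<^sub>M (grid n) (\<lambda>_. borel)) (\<lambda>\<omega>. restrict (\<epsilon>\<mu> \<omega>) (grid n))
           (Pi\<^sub>M (grid n) (\<lambda>_. borel)) (\<lambda>\<omega>. restrict (\<epsilon>\<nu> \<omega>) (grid n))"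
  shows "integrable M (\<lambda>\<omega>. signed_wasserstein 1 n (\<lambda>x. \<mu> x + \<epsilon>\<mu> \<omega> x) (\<lambda>x. \<nu> x + \<epsilon>\<nu> \<omega> x)
                            - signed_wasserstein 1 n \<mu> \<nu>) \<and>
         prob_space.expectation M
           (\<lambda>\<omega>. signed_wasserstein 1 n (\<lambda>x. \<mu> x + \<epsilon>\<mu> \<omega> x) (\<lambda>x. \<nu> x + \<epsilon>\<nu> \<omega> x)
                - signed_wasserstein 1 n \<mu> \<nu>)
         \<le> (4 * real n * log 2 (real n) + real n) / sqrt pi * \<sigma> + sqrt 2 / real n"
proof -
  interpret prob_space M by fact
  note n = \<open>n = 2 ^ \<eta>\<close> and noise = \<open>zero_sum_noise M n \<sigma> \<epsilon>\<mu>\<close> \<open>zero_sum_noise M n \<sigma> \<epsilon>\<nu>\<close>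
  have n1: "n > 1" unfolding n using \<open>\<eta> \<ge> 1\<close> by (intro one_less_power) auto
  have mass: "sum \<mu> (grid n) = 1" "sum \<nu> (grid n) = 1"
    using assms by (auto simp: prob_on_grid_def)
  define W where "W \<omega> = signed_wasserstein 1 n (\<lambda>x. \<mu> x + \<epsilon>\<mu> \<omega> x) (\<lambda>x. \<nu> x + \<epsilon>\<nu> \<omega> x)" for \<omega>
  define w where "w = signed_wasserstein 1 n \<mu> \<nu>"
  define T where "T \<omega> = tree_cost \<eta> (\<epsilon>\<mu> \<omega>) + tree_cost \<eta> (\<epsilon>\<nu> \<omega>)" for \<omega>
  define X where "X \<omega> x = \<mu> x + \<epsilon>\<mu> \<omega> x - (\<nu> x + \<epsilon>\<nu> \<omega> x)" for \<omega> x
  have sumX: "sum (X \<omega>) (grid n) = sum (\<epsilon>\<mu> \<omega>) (grid n) - sum (\<epsilon>\<nu> \<omega>) (grid n)" for \<omega>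
    using mass by (simp add: X_def sum_subtractf sum.distrib)
  have W: "W \<omega> = (if sum (X \<omega>) (grid n) = 0 then kantorovich_norm n (X \<omega>) else Inf {})" for \<omega>
    unfolding W_def X_def sumX[unfolded X_def]
    using signed_wasserstein_1_eq_kantorovich_norm signed_wasserstein_1_unequal_mass mass
    by (simp add: sum.distrib)
  have "(\<lambda>\<omega>. X \<omega> x) \<in> borel_measurable M" if "x \<in> grid n" for x
    unfolding X_def using noise[THEN zero_sum_noise_measurable, OF that]
    by (intro borel_measurable_diff borel_measurable_add) auto
  then have W_meas: "W \<in> borel_measurable M"
    unfolding W[abs_def] using n1 by (intro kantorovich_norm_measurable) auto
  have T_int: "integrable M T"
    and T_le: "expectation T \<le> 4 * real n * log 2 (real n) / sqrt pi * \<sigma>"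
  proof -
    note tree = expected_tree_cost[OF noise(1)[unfolded n]] expected_tree_cost[OF noise(2)[unfolded n]]
    note tree = tree[OF less_imp_le[OF \<open>\<sigma> > 0\<close>] \<open>\<eta> \<ge> 1\<close>]
    show "integrable M T" unfolding T_def[abs_def] by (intro Bochner_Integration.integrable_add tree)
    have "expectation T = expectation (\<lambda>\<omega>. tree_cost \<eta> (\<epsilon>\<mu> \<omega>)) + expectation (\<lambda>\<omega>. tree_cost \<eta> (\<epsilon>\<nu> \<omega>))"
      unfolding T_def[abs_def] by (intro Bochner_Integration.integral_add tree)
    also have "\<dots> \<le> 2 * 2 ^ \<eta> * real \<eta> / sqrt pi * \<sigma> + 2 * 2 ^ \<eta> * real \<eta> / sqrt pi * \<sigma>"
      by (intro add_mono tree)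
    also have "\<dots> = 4 * real n * log 2 (real n) / sqrt pi * \<sigma>"
      using n by simp
    finally show "expectation T \<le> 4 * real n * log 2 (real n) / sqrt pi * \<sigma>" .
  qed
  have bound: "AE \<omega> in M. \<bar>W \<omega> - w\<bar> \<le> T \<omega>"
    using zero_sum_noise_sum_zero[OF noise(1) n1] zero_sum_noise_sum_zero[OF noise(2) n1]
  proof eventually_elim
    case (elim \<omega>)
    let ?\<epsilon> = "\<lambda>x. \<epsilon>\<mu> \<omega> x - \<epsilon>\<nu> \<omega> x"
    have zero: "sum (X \<omega>) (grid n) = 0" "sum (\<lambda>x. \<mu> x - \<nu> x) (grid n) = 0" "sum ?\<epsilon> (grid n) = 0"
      using elim mass by (simp_all add: sumX sum_subtractf)
    have "w = kantorovich_norm n (\<lambda>x. \<mu> x - \<nu> x)"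
      unfolding w_def using mass by (intro signed_wasserstein_1_eq_kantorovich_norm) simp
    then have "\<bar>W \<omega> - w\<bar> \<le> kantorovich_norm n (\<lambda>x. X \<omega> x - (\<mu> x - \<nu> x))"
      using kantorovich_norm_diff_le[OF zero(1,2)] zero(1) by (simp add: W)
    also have "(\<lambda>x. X \<omega> x - (\<mu> x - \<nu> x)) = ?\<epsilon>" by (simp add: X_def fun_eq_iff)
    also have "kantorovich_norm n ?\<epsilon> \<le> tree_cost \<eta> ?\<epsilon>"
      using zero(3) unfolding n by (rule kantorovich_norm_le_tree_cost)
    also have "\<dots> \<le> T \<omega>" unfolding T_def by (rule tree_cost_diff_le)
    finally show ?case .
  qed
  have int: "integrable M (\<lambda>\<omega>. W \<omega> - w)"
  proof (rule Bochner_Integration.integrable_bound[OF T_int])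
    show "AE \<omega> in M. norm (W \<omega> - w) \<le> norm (T \<omega>)" using bound by eventually_elim auto
  qed (use W_meas in simp)
  have "expectation (\<lambda>\<omega>. W \<omega> - w) \<le> expectation T"
    by (rule integral_mono_AE[OF int T_int]) (use bound in eventually_elim, auto)
  also have "\<dots> \<le> 4 * real n * log 2 (real n) / sqrt pi * \<sigma>" by (rule T_le)
  also have "\<dots> \<le> (4 * real n * log 2 (real n) + real n) / sqrt pi * \<sigma> + sqrt 2 / real n"
    using \<open>\<sigma> > 0\<close> by (simp add: add_divide_distrib distrib_right)
  finally show ?thesis using int unfolding W_def w_def by blast
qed

end
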